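(* Let $X$ be a (complex) Fréchet space and let $T:X\to X$ be an $\mathcal{AP}$-hypercyclic continuous linear operator. Then $T^p$ and $\lambda T$ are $\mathcal{AP}$-hypercyclic for any integer $p\ge 1$ and any $\lambda\in\mathbb{C}$ with $|\lambda|=1$. Moreover, $T$, $T^p$ and $\lambda T$ have the same $\mathcal{AP}$-hypercyclic vectors.
   Context: $\mathcal{AP}$ is the family of all subsets of $\mathbb{N}$ that contain arbitrarily long (finite) arithmetic progressions $\{a,a+k,\dots,a+mk\}$ (common difference $k\ge 1$). For an operator $R$ on $X$, $N_R(x,U)=\{n\in\mathbb{N}: R^n x\in U\}$. A vector $x$ is $\mathcal{AP}$-hypercyclic for $R$ if $N_R(x,U)\in\mathcal{AP}$ for every nonempty open set $U\subseteq X$; $R$ is $\mathcal{AP}$-hypercyclic if it has an $\mathcal{AP}$-hypercyclic vector. *)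

theory Defs
  imports "HOL-Analysis.Analysis"
begin

text \<open>
  The underlying real structure needed for \<^const>\<open>convex\<close> is tied to the complex one by
  \<open>scale_of_real\<close>. The metric is only required to exist, so that the structure is the
  topological vector space and not a chosen metric on it; its existence implies Hausdorffness.
\<close>

locale complex_frechet_space = vector_space scale
  for scale :: "complex \<Rightarrow> 'a::{real_vector, topological_ab_group_add} \<Rightarrow> 'a" +
  assumes scale_of_real: "scale (complex_of_real r) x = r *\<^sub>R x"
    and continuous_scale: "continuous_on UNIV (\<lambda>(c, x). scale c x)"
    and locally_convex:
      "open (U :: 'a set) \<Longrightarrow> 0 \<in> U \<Longrightarrow> \<exists>C. open C \<and> convex C \<and> 0 \<in> C \<and> C \<subseteq> U"
    and complete_invariant_metric:
      "\<exists>d :: 'a \<Rightarrow> 'a \<Rightarrow> real. Metric_space UNIV d \<and> Metric_space.mtopology UNIV d = euclidean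
         \<and> Metric_space.mcomplete UNIV d \<and> (\<forall>x y z. d (x + z) (y + z) = d x y)"

definition AP :: "nat set set" where
  "AP = {A. \<forall>m. \<exists>a k. k \<ge> 1 \<and> (\<forall>j\<le>m. a + j * k \<in> A)}"

definition return_set :: "('a \<Rightarrow> 'a) \<Rightarrow> 'a \<Rightarrow> 'a set \<Rightarrow> nat set" where
  "return_set R x U = {n. (R ^^ n) x \<in> U}"

definition AP_hypercyclic_vector :: "('a::topological_space \<Rightarrow> 'a) \<Rightarrow> 'a \<Rightarrow> bool" where
  "AP_hypercyclic_vector R x \<longleftrightarrow> (\<forall>U. open U \<and> U \<noteq> {} \<longrightarrow> return_set R x U \<in> AP)"

definition AP_hypercyclic :: "('a::topological_space \<Rightarrow> 'a) \<Rightarrow> bool" where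
  "AP_hypercyclic R \<longleftrightarrow> (\<exists>x. AP_hypercyclic_vector R x)"

end

theory Submission
  imports Defs "HOL-Computational_Algebra.Fundamental_Theorem_Algebra"
begin

text \<open>
  Both powers and rotations reduce to one statement about return times, \<open>AP_return_near_one\<close>: for an
  \<open>AP\<close>-hypercyclic vector \<open>x\<close>, a nonempty open set \<open>U\<close> and a complex number \<open>lam\<close> of modulus \<open>1\<close>, the
  times \<open>n\<close> with \<open>(T ^^ n) x \<in> U\<close> at which moreover \<open>lam ^ n\<close> is close to \<open>1\<close> still contain
  arbitrarily long progressions. For \<open>lam\<close> a primitive \<open>p\<close>-th root of unity these times are multiples
  of \<open>p\<close>, which gives the result for \<open>T ^^ p\<close>; for \<open>lam = \<mu>\<close> the vectors \<open>\<mu> ^ n (T ^^ n) x\<close> and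
  \<open>(T ^^ n) x\<close> are almost equal at these times, which gives the result for \<open>\<mu> T\<close>. The converse for
  powers is the dilation of a progression by \<open>p\<close>, and the converse for rotations is the same result
  applied to \<open>\<mu> T\<close> and \<open>inverse \<mu>\<close>.

  For the statement on progressions one needs that single visits to \<open>U\<close> with \<open>lam ^ n\<close> near \<open>1\<close> exist
  (\<open>visits_near_one\<close>). A long progression of visits to a small neighbourhood of \<open>x\<close> has a
  subprogression along which \<open>lam ^ n\<close> is almost constant, by simultaneous recurrence of rotations,
  and a translation of it by a suitable single visit makes that constant almost \<open>1\<close>.

  The existence of single visits is where linearity enters. The angles that occur in the limit while
  the orbit of \<open>x\<close> returns to \<open>x\<close> form a closed subgroup of the circle, and the claim is that \<open>lam\<close>
  belongs to it (\<open>lam_in_fibre\<close>). A proper closed subgroup consists of the \<open>k\<close>-th roots of unity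
  and would define a continuous map \<open>\<phi>\<close> to the circle, on all vectors with dense orbit, for
  which \<open>\<phi> (T y) = lam ^ k * \<phi> y\<close>. Since every nonzero polynomial in \<open>T\<close> maps \<open>x\<close> to a vector with
  dense orbit (\<open>dense_orbit_poly_op\<close>), the path that runs through \<open>x\<close>, \<open>T x\<close>, up to \<open>(T ^^ N) x\<close>
  and then back to a nearby \<open>x\<close> can be contracted inside the domain of \<open>\<phi>\<close>. Hence \<open>\<phi>\<close> does not
  wind along it, although each of the \<open>N\<close> steps contributes the same angle; letting \<open>N\<close> grow forces
  this angle to vanish, so \<open>lam ^ k = 1\<close> and \<open>lam\<close> belongs to the subgroup after all.
\<close>

section \<open>Rotations of the circle\<close>

lemma unit_power_near_one:
  fixes z :: complex
  assumes z: "cmod z = 1" and e: "e > 0"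
  shows "\<exists>q\<ge>1. cmod (z ^ q - 1) < e"
proof -
  have "\<forall>n. z ^ n \<in> sphere 0 1"
    by (simp add: norm_power z)
  moreover have "seq_compact (sphere (0::complex) 1)"
    using compact_sphere compact_imp_seq_compact by blast
  ultimately obtain l r where r: "strict_mono r" "((\<lambda>n. z ^ n) \<circ> r) \<longlonglongrightarrow> l"
    unfolding seq_compact_def by meson
  have "Cauchy (\<lambda>n. z ^ r n)"
    using r(2) LIMSEQ_imp_Cauchy by (auto simp: o_def)
  then obtain M where M: "\<forall>m\<ge>M. \<forall>n\<ge>M. dist (z ^ r m) (z ^ r n) < e"
    using e unfolding Cauchy_def by metis
  define q where "q = r (Suc M) - r M"
  have lt: "r M < r (Suc M)"
    using r(1) by (simp add: strict_mono_def)
  have "z ^ r (Suc M) - z ^ r M = z ^ r M * (z ^ q - 1)"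
    using lt by (simp add: q_def right_diff_distrib flip: power_add)
  then have "cmod (z ^ r (Suc M) - z ^ r M) = cmod (z ^ q - 1)"
    by (simp add: norm_mult norm_power z)
  moreover have "dist (z ^ r (Suc M)) (z ^ r M) < e"
    using M by simp
  ultimately show ?thesis
    using lt by (intro exI[of _ q]) (auto simp: q_def dist_norm)
qed

text \<open>
  The bound on the exponent is independent of the rotation, because finitely many of the open
  sets on which a fixed power is close to \<open>1\<close> cover the circle. Hence one can decide how long a
  progression to ask for before its common difference is known.
\<close>
lemma unit_power_near_one_uniform:
  assumes e: "e > 0"
  shows "\<exists>Q. \<forall>z. cmod z = 1 \<longrightarrow> (\<exists>q. 1 \<le> q \<and> q \<le> Q \<and> cmod (z ^ q - 1) < e)"
proof -
  let ?O = "\<lambda>q. {z::complex. cmod (z ^ q - 1) < e}"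
  have op: "open (?O q)" if "q \<in> {1..}" for q
    by (intro open_Collect_less continuous_intros)
  have cover: "sphere 0 1 \<subseteq> (\<Union>q\<in>{1..}. ?O q)"
    using unit_power_near_one[OF _ e] by fastforce
  obtain C where C: "C \<subseteq> {1..}" "finite C" "sphere 0 1 \<subseteq> (\<Union>q\<in>C. ?O q)"
    by (rule compactE_image[OF compact_sphere op cover])
  have "\<exists>q. 1 \<le> q \<and> q \<le> Max C \<and> cmod (z ^ q - 1) < e" if "cmod z = 1" for z
  proof -
    obtain q where "q \<in> C" "z \<in> ?O q"
      using C(3) \<open>cmod z = 1\<close> by (auto simp: subset_iff)
    then show ?thesis
      using C by (intro exI[of _ q]) auto
  qed
  then show ?thesis by blast
qed

text \<open>
  A power of \<open>z ^ n\<close> almost inverts it, so every point of the orbit closure is carried near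
  \<open>1\<close> after some waiting time \<open>s\<close>; by compactness finitely many waiting times suffice.
\<close>
lemma unit_orbit_finite_return:
  assumes z: "cmod z = 1" and e: "e > 0"
  shows "\<exists>F. finite F \<and> (\<forall>n. \<exists>s\<in>F. cmod (z ^ (n + s) - 1) < e)"
proof -
  let ?K = "closure (range (\<lambda>n. z ^ n))"
  let ?O = "\<lambda>s. {w. cmod (w * z ^ s - 1) < e}"
  have "bounded (range (\<lambda>n. z ^ n))"
    by (auto simp: bounded_iff norm_power z)
  then have K: "compact ?K" by simp
  have op: "open (?O s)" if "s \<in> UNIV" for s
    by (intro open_Collect_less continuous_intros)
  have cover: "?K \<subseteq> (\<Union>s\<in>UNIV. ?O s)"
  proof
    fix w assume "w \<in> ?K"
    then obtain n where n: "cmod (z ^ n - w) < e / 2"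
      using e unfolding closure_approachable dist_norm by (metis half_gt_zero rangeE)
    obtain q where q: "q \<ge> 1" "cmod ((z ^ n) ^ q - 1) < e / 2"
      using unit_power_near_one[of "z ^ n" "e / 2"] e by (auto simp: norm_power z)
    define s where "s = n * (q - 1)"
    have "z ^ n * z ^ s = (z ^ n) ^ q"
      using q(1) by (cases q) (simp_all add: s_def power_add power_mult)
    then have "w * z ^ s - 1 = ((z ^ n) ^ q - 1) - (z ^ n - w) * z ^ s"
      by (simp add: algebra_simps)
    then have "cmod (w * z ^ s - 1) \<le> cmod ((z ^ n) ^ q - 1) + cmod ((z ^ n - w) * z ^ s)"
      by (metis norm_triangle_ineq4)
    also have "cmod ((z ^ n - w) * z ^ s) = cmod (z ^ n - w)"
      by (simp add: norm_mult norm_power z)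
    finally show "w \<in> (\<Union>s\<in>UNIV. ?O s)"
      using n q(2) by (intro UN_I[of s]) auto
  qed
  obtain F where F: "finite F" "?K \<subseteq> (\<Union>s\<in>F. ?O s)"
    by (rule compactE_image[OF K op cover])
  have "\<exists>s\<in>F. cmod (z ^ (n + s) - 1) < e" for n
  proof -
    have "z ^ n \<in> ?K"
      by (rule subsetD[OF closure_subset]) simp
    then show ?thesis
      using F(2) by (auto simp: power_add)
  qed
  with F(1) show ?thesis by blast
qed

lemma unit_power_diff:
  fixes z :: complex
  assumes "cmod z = 1"
  shows "cmod (z ^ i - 1) \<le> real i * cmod (z - 1)"
proof (induction i)
  case (Suc i)
  have "z ^ Suc i - 1 = z * (z ^ i - 1) + (z - 1)"
    by (simp add: algebra_simps)
  then have "cmod (z ^ Suc i - 1) \<le> cmod (z * (z ^ i - 1)) + cmod (z - 1)"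
    by (metis norm_triangle_ineq)
  also have "\<dots> \<le> real i * cmod (z - 1) + cmod (z - 1)"
    using Suc assms by (simp add: norm_mult)
  finally show ?case
    by (simp add: algebra_simps)
qed simp

text \<open>
  The powers of a primitive \<open>p\<close>-th root of unity form a finite set, so closeness to \<open>1\<close> detects
  divisibility of the exponent by \<open>p\<close>. In this way powers of \<open>T\<close> are controlled by a
  rotation.
\<close>
lemma root_of_unity_gap:
  assumes "p \<ge> 1"
  shows "\<exists>z e. cmod z = 1 \<and> e > 0 \<and> (\<forall>n. cmod (z ^ n - 1) < e \<longrightarrow> p dvd n)"
proof -
  define z where "z = exp (2 * of_real pi * \<i> / of_nat p)"
  have z_pow: "z ^ n = 1 \<longleftrightarrow> p dvd n" for n
  proof -
    have "z ^ n = exp (2 * of_real pi * \<i> * of_nat n / of_nat p)"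
      by (simp add: z_def mult.commute flip: exp_of_nat_mult)
    then show ?thesis
      using complex_root_unity_eq_1[OF assms, of n] by simp
  qed
  define e where "e = Min (insert 1 ((\<lambda>r. cmod (z ^ r - 1)) ` {1..<p}))"
  have "e > 0"
    unfolding e_def
    by (subst Min_gr_iff) (auto simp: z_pow dest: dvd_imp_le)
  moreover have "p dvd n" if n: "cmod (z ^ n - 1) < e" for n
  proof (rule ccontr)
    assume "\<not> p dvd n"
    then have "n mod p \<in> {1..<p}"
      using assms by (auto simp: dvd_eq_mod_eq_0 Suc_le_eq)
    then have "e \<le> cmod (z ^ (n mod p) - 1)"
      unfolding e_def by (intro Min_le) auto
    moreover have "z ^ n = z ^ (n mod p)"
    proof -
      have "z ^ n = (z ^ p) ^ (n div p) * z ^ (n mod p)"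
        by (simp flip: power_mult power_add)
      then show ?thesis
        using z_pow[of p] by simp
    qed
    ultimately show False
      using n by simp
  qed
  moreover have "cmod z = 1"
    by (simp add: z_def norm_exp_eq_Re)
  ultimately show ?thesis by blast
qed

text \<open>
  Walking around the circle in steps of angle \<open>\<theta>\<close>, one stops at the last step before \<open>w\<close>: the
  remaining angle is at most \<open>\<theta>\<close>, and chords grow with the angle up to \<open>pi\<close>.
\<close>
lemma rotation_powers_dense:
  assumes \<theta>: "0 < \<theta>" "\<theta> \<le> pi" and w: "cmod w = 1"
  shows "\<exists>n. cmod (cis \<theta> ^ n - w) \<le> cmod (cis \<theta> - 1)"
proof -
  have chord: "(cmod (cis t - 1))\<^sup>2 = 2 - 2 * cos t" for t
  proof -
    have "(cmod (cis t - 1))\<^sup>2 = (cos t - 1)\<^sup>2 + (sin t)\<^sup>2"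
      by (simp add: cmod_power2)
    then show ?thesis
      using sin_cos_squared_add[of t] by (simp add: power2_eq_square algebra_simps)
  qed
  obtain \<tau> where \<tau>: "0 \<le> \<tau>" "w = cis \<tau>"
    using Arg2pi_eq[of w] Arg2pi_ge_0[of w] w by (metis cis_conv_exp mult.left_neutral of_real_1)
  define n where "n = nat \<lfloor>\<tau> / \<theta>\<rfloor>"
  define d where "d = \<tau> - real n * \<theta>"
  have "real n = of_int \<lfloor>\<tau> / \<theta>\<rfloor>"
    using \<tau> \<theta> by (simp add: n_def)
  then have "real n \<le> \<tau> / \<theta>" "\<tau> / \<theta> < real n + 1"
    by linarith+
  then have d: "0 \<le> d" "d < \<theta>"
    using \<theta> by (auto simp: d_def field_simps)
  have w_eq: "w = cis \<theta> ^ n * cis d"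
    by (simp add: \<tau>(2) d_def Complex.DeMoivre cis_mult)
  have "cis \<theta> ^ n - w = - (cis \<theta> ^ n * (cis d - 1))"
    unfolding w_eq by (simp add: algebra_simps)
  then have "cmod (cis \<theta> ^ n - w) = cmod (cis d - 1)"
    by (simp add: norm_mult norm_power)
  moreover have "(cmod (cis d - 1))\<^sup>2 \<le> (cmod (cis \<theta> - 1))\<^sup>2"
    unfolding chord using cos_monotone_0_pi_le[of d \<theta>] d \<theta> by simp
  ultimately show ?thesis
    by (intro exI[of _ n]) (simp add: power2_le_iff_abs_le)
qed

text \<open>
  Recurrence of rotations provides inverses, so \<open>H\<close> is a group. If \<open>H\<close> is finite of order \<open>k\<close>,
  multiplication by \<open>a\<close> permutes \<open>H\<close> and so preserves the product of all elements; thus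
  \<open>a ^ k = 1\<close>, and \<open>H\<close> exhausts the \<open>k\<close>-th roots of unity because there are only \<open>k\<close> of them. If \<open>H\<close> is infinite, quotients of nearby elements are arbitrarily
  small nontrivial rotations, whose powers come close to every point of the circle.
\<close>
lemma closed_circle_semigroup:
  fixes H :: "complex set"
  assumes H: "closed H" "H \<subseteq> sphere 0 1" "1 \<in> H"
    and mult: "\<And>a b. a \<in> H \<Longrightarrow> b \<in> H \<Longrightarrow> a * b \<in> H"
  shows "H = sphere 0 1 \<or> (\<exists>k\<ge>1. H = {z. z ^ k = 1})"
proof -
  have unit: "cmod a = 1" if "a \<in> H" for a
    using H(2) that by auto
  have pow: "a ^ n \<in> H" if "a \<in> H" for a n
    using that by (induction n) (auto simp: H(3) mult)
  have inv: "inverse a \<in> H" if a: "a \<in> H" for a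
  proof -
    have nz: "a \<noteq> 0"
      using unit[OF a] by auto
    have "inverse a \<in> closure H"
      unfolding closure_approachable
    proof (intro allI impI)
      fix e :: real assume "e > 0"
      then obtain q where q: "q \<ge> 1" "cmod (a ^ q - 1) < e"
        using unit_power_near_one[OF unit[OF a]] by blast
      have "a ^ q - 1 = a * (a ^ (q - 1) - inverse a)"
        using q(1) nz by (cases q) (simp_all add: right_diff_distrib)
      then have "cmod (a ^ (q - 1) - inverse a) < e"
        using q(2) unit[OF a] by (simp add: norm_mult)
      then show "\<exists>y\<in>H. dist y (inverse a) < e"
        using pow[OF a] by (auto simp: dist_norm)
    qed
    then show ?thesis
      using H(1) by simp
  qed
  show ?thesis
  proof (cases "finite H")
    case True
    define k where "k = card H"
    have "k \<ge> 1"
      using True H(3) by (auto simp: k_def Suc_le_eq card_gt_0_iff)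
    have root: "a ^ k = 1" if a: "a \<in> H" for a
    proof -
      have nz: "a \<noteq> 0" using unit[OF a] by auto
      have inj: "inj_on ((*) a) H"
        using nz by (auto intro: inj_onI)
      have "(*) a ` H = H"
        by (rule card_subset_eq[OF True]) (use inj mult a in \<open>auto simp: card_image\<close>)
      then have "\<Prod>H = (\<Prod>b\<in>H. a * b)"
        using prod.reindex[OF inj, of "\<lambda>x. x"] by simp
      also have "\<dots> = a ^ k * \<Prod>H"
        by (simp add: prod.distrib k_def)
      finally have "\<Prod>H = a ^ k * \<Prod>H" .
      moreover have "\<Prod>H \<noteq> 0"
        using True unit[of 0] by auto
      ultimately show ?thesis by simp
    qed
    have "finite {z::complex. z ^ k = 1}"
      using \<open>k \<ge> 1\<close> by (intro finite_roots_unity) auto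
    moreover have "card {z::complex. z ^ k = 1} = card H"
      using \<open>k \<ge> 1\<close> card_roots_unity_eq[of k] by (simp add: k_def)
    ultimately have "H = {z. z ^ k = 1}"
      using root by (intro card_subset_eq) auto
    with \<open>k \<ge> 1\<close> show ?thesis by blast
  next
    case False
    have "w \<in> H" if w: "cmod w = 1" for w
    proof -
      have "w \<in> closure H"
        unfolding closure_approachable
      proof (intro allI impI)
        fix e :: real assume e: "e > 0"
        obtain l where l: "l islimpt H"
          using False H(1,2) compact_sphere[of "0::complex" 1]
          by (meson compact_eq_Bolzano_Weierstrass)
        obtain a where a: "a \<in> H" "a \<noteq> l" "dist a l < e / 2"
          using l e unfolding islimpt_approachable by (meson half_gt_zero)
        obtain b where b: "b \<in> H" "b \<noteq> l" "dist b l < dist a l"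
          using l a(2) unfolding islimpt_approachable by (meson zero_less_dist_iff)
        have "a \<noteq> b" using b by auto
        define h where "h = a * inverse b"
        have h: "h \<in> H" using a b inv mult by (simp add: h_def)
        have bnz: "b \<noteq> 0"
          using unit[OF b(1)] by auto
        have ab: "a - b = b * (h - 1)"
          using bnz by (simp add: h_def right_diff_distrib)
        have "h \<noteq> 1"
          using \<open>a \<noteq> b\<close> ab by auto
        have "dist a b < e"
          using a(3) b(3) dist_triangle2[of a b l] by linarith
        then have he: "cmod (h - 1) < e"
          using unit[OF b(1)] ab by (simp add: dist_norm norm_mult)
        have hnz: "h \<noteq> 0"
          using unit[OF h] by auto
        define \<theta> where "\<theta> = Arg h"
        have cis: "h = cis \<theta>"
          using unit[OF h] cis_Arg[of h] norm_zero[where 'a = complex]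
          by (force simp: \<theta>_def sgn_eq)
        have \<theta>_le: "- pi < \<theta>" "\<theta> \<le> pi"
          using Arg_bounded[of h] by (simp_all add: \<theta>_def)
        have "\<theta> \<noteq> 0"
          using cis \<open>h \<noteq> 1\<close> by auto
        have "\<exists>g\<in>H. \<exists>t. g = cis t \<and> 0 < t \<and> t \<le> pi \<and> cmod (g - 1) < e"
        proof (cases "\<theta> > 0")
          case True
          then show ?thesis
            using h he cis \<theta>_le by blast
        next
          case False
          have "h * (inverse h - 1) = - (h - 1)"
            using hnz by (simp add: right_diff_distrib)
          then have "cmod (inverse h - 1) = cmod (h - 1)"
            using unit[OF h] by (metis mult_1 norm_minus_cancel norm_mult)
          moreover have "inverse h = cis (- \<theta>)"
            unfolding cis by simp
          ultimately show ?thesis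
            using inv[OF h] he False \<open>\<theta> \<noteq> 0\<close> \<theta>_le
            by (intro bexI[of _ "inverse h"] exI[of _ "- \<theta>"]) auto
        qed
        then obtain g t where g: "g \<in> H" "g = cis t" "0 < t" "t \<le> pi" "cmod (g - 1) < e"
          by blast
        obtain n where "cmod (g ^ n - w) \<le> cmod (g - 1)"
          using rotation_powers_dense[OF g(3,4) w] unfolding g(2) by blast
        then have "cmod (g ^ n - w) < e"
          using g(5) by simp
        then show "\<exists>y\<in>H. dist y w < e"
          using pow[OF g(1)] by (auto simp: dist_norm)
      qed
      then show "w \<in> H"
        using H(1) by simp
    qed
    then have "H = sphere 0 1"
      using H(2) by auto
    then show ?thesis by blast
  qed
qed

section \<open>Lifting and the tube lemma\<close>

lemma exp_constant_imp_constant: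
  fixes g :: "'b::topological_space \<Rightarrow> complex"
  assumes "connected S" "continuous_on S g"
    and const: "\<And>x y. x \<in> S \<Longrightarrow> y \<in> S \<Longrightarrow> exp (g x) = exp (g y)"
    and "x \<in> S" "y \<in> S"
  shows "g x = g y"
proof -
  have "g constant_on S"
  proof (rule continuous_discrete_range_constant[OF assms(1,2)])
    show "\<exists>e>0. \<forall>y. y \<in> S \<and> g y \<noteq> g x \<longrightarrow> e \<le> norm (g y - g x)" if "x \<in> S" for x
    proof (intro exI[of _ "2 * pi"] conjI allI impI)
      fix y assume y: "y \<in> S \<and> g y \<noteq> g x"
      have "\<not> \<bar>Im (g y) - Im (g x)\<bar> < 2 * pi"
        using exp_complex_eqI const y that by blast
      then show "2 * pi \<le> norm (g y - g x)"
        using abs_Im_le_cmod[of "g y - g x"] by simp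
    qed simp
  qed
  then show ?thesis
    using assms(4,5) by (metis constant_on_def)
qed

text \<open>
  The tube lemma, with the tube stated as the complement of a closed set: finitely many boxes
  that miss \<open>C\<close> cover \<open>{y} \<times> K\<close>, and their first sides are intersected.
\<close>
lemma closed_avoid_tube:
  fixes C :: "('b::topological_space \<times> 'c::topological_space) set"
  assumes C: "closed C" and K: "compact K" and avoid: "\<And>k. k \<in> K \<Longrightarrow> (y, k) \<notin> C"
  shows "\<exists>U. open U \<and> y \<in> U \<and> (\<forall>u\<in>U. \<forall>k\<in>K. (u, k) \<notin> C)"
proof -
  have "\<exists>A B. open A \<and> open B \<and> y \<in> A \<and> k \<in> B \<and> A \<times> B \<subseteq> - C" if "k \<in> K" for k
    by (rule open_prod_elim[of "- C" "(y, k)"]) (use C avoid[OF that] in auto)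
  then obtain A B where AB: "\<And>k. k \<in> K \<Longrightarrow>
      open (A k) \<and> open (B k) \<and> y \<in> A k \<and> k \<in> B k \<and> A k \<times> B k \<subseteq> - C"
    by metis
  have op: "open (B k)" if "k \<in> K" for k
    using AB[OF that] by simp
  have cover: "K \<subseteq> (\<Union>k\<in>K. B k)"
    using AB by blast
  obtain F where F: "F \<subseteq> K" "finite F" "K \<subseteq> (\<Union>k\<in>F. B k)"
    by (rule compactE_image[OF K op cover])
  show ?thesis
  proof (intro exI[of _ "\<Inter>k\<in>F. A k"] conjI ballI)
    show "open (\<Inter>k\<in>F. A k)"
      using F AB by (intro open_INT) auto
    show "y \<in> (\<Inter>k\<in>F. A k)"
      using F AB by auto
    fix u k assume "u \<in> (\<Inter>k\<in>F. A k)" "k \<in> K"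
    then obtain i where i: "i \<in> F" "u \<in> A i" "k \<in> B i"
      using F(3) by blast
    then have "A i \<times> B i \<subseteq> - C"
      using F(1) AB by blast
    then show "(u, k) \<notin> C"
      using i by blast
  qed
qed

text \<open>
  The winding argument. Continue a logarithm \<open>g\<close> of \<open>f\<close> over the rectangle. By the shift relation
  \<open>g\<close> increases along the edge \<open>s = 0\<close> by the same amount \<open>c\<close> in every unit of time, in total by
  \<open>N * c\<close>. Along the edges \<open>t = 0\<close> and \<open>s = 1\<close> it is constant, and along the edge \<open>t = N\<close> the
  function \<open>f\<close> stays in the right half plane, so that \<open>g\<close> changes there by the principal logarithm,
  which has modulus at most \<open>pi\<close>. Going around the rectangle bounds \<open>N * c\<close>.
\<close>
lemma circle_lift_shift:
  fixes f :: "real \<times> real \<Rightarrow> complex"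
  assumes cont: "continuous_on ({0..1} \<times> {0..real N}) f"
    and unit: "\<And>s t. s \<in> {0..1} \<Longrightarrow> t \<in> {0..real N} \<Longrightarrow> cmod (f (s, t)) = 1"
    and shift: "\<And>t. 0 \<le> t \<Longrightarrow> t + 1 \<le> real N \<Longrightarrow> f (0, t + 1) = w * f (0, t)"
    and left: "\<And>s. s \<in> {0..1} \<Longrightarrow> f (s, 0) = 1"
    and top: "\<And>t. t \<in> {0..real N} \<Longrightarrow> f (1, t) = 1"
    and right: "\<And>s. s \<in> {0..1} \<Longrightarrow> Re (f (s, real N)) > 0"
    and N: "N \<ge> 1"
  shows "\<exists>c. exp c = w \<and> real N * cmod c \<le> pi"
proof -
  let ?K = "{0..1::real} \<times> {0..real N}"
  have "contractible ?K"
    by (intro convex_imp_contractible convex_Times) auto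
  moreover have "f z \<noteq> 0" if "z \<in> ?K" for z
    using unit that by fastforce
  ultimately obtain g where g: "continuous_on ?K g" and fg: "\<And>z. z \<in> ?K \<Longrightarrow> f z = exp (g z)"
    using continuous_logarithm_on_contractible[OF cont] by metis
  have g_cont: "continuous_on S (\<lambda>z. g (p z))"
    if "continuous_on S p" "p ` S \<subseteq> ?K" for p and S :: "real set"
    using continuous_on_compose2[OF g that] .
  define c where "c = g (0, 1) - g (0, 0)"
  \<comment> \<open>The increment over unit time is a continuous logarithm of the constant \<open>w\<close>.\<close>
  have step: "g (0, t + 1) - g (0, t) = c" if t: "t \<in> {0..real N - 1}" for t
  proof -
    have "g (0, t + 1) - g (0, t) = g (0, 0 + 1) - g (0, 0)"
    proof (rule exp_constant_imp_constant[where S = "{0..real N - 1}"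
          and g = "\<lambda>t. g (0, t + 1) - g (0, t)"])
      show "continuous_on {0..real N - 1} (\<lambda>t. g (0, t + 1) - g (0, t))"
        by (intro continuous_on_diff g_cont continuous_intros) auto
      have "exp (g (0, t + 1) - g (0, t)) = w" if "t \<in> {0..real N - 1}" for t
        using shift[of t] that fg[of "(0, t)"] fg[of "(0, t + 1)"]
        by (simp add: exp_diff)
      then show "exp (g (0, x + 1) - g (0, x)) = exp (g (0, y + 1) - g (0, y))"
        if "x \<in> {0..real N - 1}" "y \<in> {0..real N - 1}" for x y
        using that by metis
    qed (use t N in auto)
    then show ?thesis by (simp add: c_def)
  qed
  have walk: "g (0, real n) = g (0, 0) + of_nat n * c" if "n \<le> N" for n
    using that
  proof (induction n)
    case (Suc n)
    then show ?case
      using step[of "real n"] by (simp add: algebra_simps)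
  qed simp
  have "g (0, 0) = g (1, 0)"
  proof (rule exp_constant_imp_constant[where S = "{0..1}" and g = "\<lambda>s. g (s, 0)"])
    show "continuous_on {0..1} (\<lambda>s. g (s, 0))"
      by (intro g_cont continuous_intros) auto
    have "exp (g (s, 0)) = 1" if "s \<in> {0..1}" for s
      using fg[of "(s, 0)"] left[OF that] that by simp
    then show "exp (g (x, 0)) = exp (g (y, 0))" if "x \<in> {0..1}" "y \<in> {0..1}" for x y
      using that by metis
  qed auto
  also have "\<dots> = g (1, real N)"
  proof (rule exp_constant_imp_constant[where S = "{0..real N}" and g = "\<lambda>t. g (1, t)"])
    show "continuous_on {0..real N} (\<lambda>t. g (1, t))"
      by (intro g_cont continuous_intros) auto
    have "exp (g (1, t)) = 1" if "t \<in> {0..real N}" for t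
      using fg[of "(1, t)"] top[OF that] that by simp
    then show "exp (g (1, x)) = exp (g (1, y))" if "x \<in> {0..real N}" "y \<in> {0..real N}" for x y
      using that by metis
  qed auto
  finally have corner: "g (0, 0) = g (1, real N)" .
  \<comment> \<open>On the edge \<open>t = N\<close> the lift differs from the principal logarithm by a constant.\<close>
  have nonpos: "f (s, real N) \<notin> \<real>\<^sub>\<le>\<^sub>0" if "s \<in> {0..1}" for s
    using right[OF that] by (auto simp: complex_nonpos_Reals_iff)
  have "g (0, real N) - Ln (f (0, real N)) = g (1, real N) - Ln (f (1, real N))"
  proof (rule exp_constant_imp_constant[where S = "{0..1}"
        and g = "\<lambda>s. g (s, real N) - Ln (f (s, real N))"])
    show "continuous_on {0..1} (\<lambda>s. g (s, real N) - Ln (f (s, real N)))"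
      by (intro continuous_on_diff continuous_on_Ln' g_cont continuous_intros nonpos
          continuous_on_compose2[OF cont]) auto
    have "exp (g (s, real N) - Ln (f (s, real N))) = 1" if "s \<in> {0..1}" for s
      using nonpos[OF that] fg[of "(s, real N)"] that by (auto simp: exp_diff)
    then show "exp (g (x, real N) - Ln (f (x, real N))) = exp (g (y, real N) - Ln (f (y, real N)))"
      if "x \<in> {0..1}" "y \<in> {0..1}" for x y
      using that by metis
  qed auto
  then have "of_nat N * c = Ln (f (0, real N))"
    using walk[of N] corner top[of "real N"] by (simp add: algebra_simps)
  moreover have "cmod (Ln (f (0, real N))) \<le> pi"
  proof -
    have f0: "cmod (f (0, real N)) = 1" "f (0, real N) \<noteq> 0"
      using unit[of 0 "real N"] by auto
    then have "Re (Ln (f (0, real N))) = 0" by simp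
    then show ?thesis
      using mpi_less_Im_Ln[OF f0(2)] Im_Ln_le_pi[OF f0(2)] by (simp add: cmod_eq_Im)
  qed
  ultimately have "real N * cmod c \<le> pi"
    by (metis norm_mult norm_of_nat)
  moreover have "exp c = w"
    using shift[of 0] fg[of "(0, 0)"] fg[of "(0, 1)"] N by (simp add: c_def exp_diff)
  ultimately show ?thesis by blast
qed

section \<open>Vectors with dense orbit\<close>

locale complex_frechet_operator = complex_frechet_space scale
  for scale :: "complex \<Rightarrow> 'a::{real_vector, topological_ab_group_add} \<Rightarrow> 'a" +
  fixes T :: "'a \<Rightarrow> 'a"
  assumes linear_T: "Vector_Spaces.linear scale scale T"
    and continuous_T: "continuous_on UNIV T"
begin

sublocale T: Vector_Spaces.linear scale scale T
  by (rule linear_T)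

lemma continuous_on_scale:
  "continuous_on S f \<Longrightarrow> continuous_on S g \<Longrightarrow> continuous_on S (\<lambda>y. scale (f y) (g y))"
  using continuous_on_compose2[OF continuous_scale continuous_on_Pair] by auto

lemma continuous_on_T: "continuous_on S f \<Longrightarrow> continuous_on S (\<lambda>y. T (f y))"
  using continuous_on_compose2[OF continuous_T] by auto

lemma continuous_on_T_funpow: "continuous_on S f \<Longrightarrow> continuous_on S (\<lambda>y. (T ^^ n) (f y))"
  by (induction n) (auto intro: continuous_on_T)

definition dense_orbit :: "'a \<Rightarrow> bool" where
  "dense_orbit y \<longleftrightarrow> closure (range (\<lambda>n. (T ^^ n) y)) = UNIV"

lemma dense_orbit_visits:
  assumes "dense_orbit y" "open U" "z \<in> U"
  shows "\<exists>n. (T ^^ n) y \<in> U"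
proof -
  have "z \<in> closure (range (\<lambda>n. (T ^^ n) y))"
    using assms(1) by (simp add: dense_orbit_def)
  then show ?thesis
    using assms(2,3) unfolding closure_iff_nhds_not_empty by fastforce
qed

lemma dense_orbit_image:
  assumes A: "continuous_on UNIV A" "closure (range A) = UNIV" "\<And>z. A (T z) = T (A z)"
    and y: "dense_orbit y"
  shows "dense_orbit (A y)"
proof -
  have comm: "(T ^^ n) (A y) = A ((T ^^ n) y)" for n
    by (induction n) (simp_all add: A(3))
  have "range A = A ` closure (range (\<lambda>n. (T ^^ n) y))"
    using y by (simp add: dense_orbit_def)
  also have "\<dots> \<subseteq> closure (A ` range (\<lambda>n. (T ^^ n) y))"
    by (rule continuous_image_closure_subset[OF A(1)]) simp
  also have "A ` range (\<lambda>n. (T ^^ n) y) = range (\<lambda>n. (T ^^ n) (A y))"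
    by (auto simp: comm)
  finally have "closure (range A) \<subseteq> closure (range (\<lambda>n. (T ^^ n) (A y)))"
    by (simp add: closure_minimal)
  then show ?thesis
    using A(2) by (auto simp: dense_orbit_def)
qed

text \<open>
  The tube lemma applied to scalar multiplication over the compact unit disc of scalars.
\<close>
lemma absorbing_neighbourhood:
  assumes U: "open U" "0 \<in> U"
  shows "\<exists>V. open V \<and> 0 \<in> V \<and> (\<forall>v\<in>V. \<forall>c. cmod c \<le> 1 \<longrightarrow> scale c v \<in> U)"
proof -
  let ?C = "{p. scale (snd p) (fst p) \<in> - U}"
  have "closed ?C"
    by (rule closed_vimage[unfolded vimage_def])
      (use U(1) in \<open>auto intro!: continuous_on_scale continuous_intros\<close>)
  then have "\<exists>V. open V \<and> 0 \<in> V \<and> (\<forall>v\<in>V. \<forall>c\<in>cball 0 1. (v, c) \<notin> ?C)"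
    by (rule closed_avoid_tube) (use U in auto)
  then show ?thesis
    by auto
qed

text \<open>
  Let \<open>M\<close> be the closure of the range of \<open>T - \<alpha>\<close>. Modulo \<open>M\<close> the orbit of \<open>x\<close> consists of the
  vectors \<open>\<alpha> ^ n x\<close>, whose coefficients stay outside the open unit disc or inside the
  closed one. If \<open>x\<close> were not in \<open>M\<close>, the orbit would therefore miss a neighbourhood of \<open>0\<close>
  (for \<open>|\<alpha>| \<ge> 1\<close>) or of \<open>2 x\<close> (for \<open>|\<alpha>| < 1\<close>). So \<open>x\<close> lies in \<open>M\<close>, and with it the whole dense orbit.
\<close>
lemma dense_range_minus_scale:
  assumes x: "dense_orbit x"
  shows "closure (range (\<lambda>y. T y - scale \<alpha> y)) = UNIV"
proof -
  define A where "A y = T y - scale \<alpha> y" for y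
  have A_T: "A (T y) = T (A y)" for y
    by (simp add: A_def T.diff T.scale)
  have A_add: "A y + A z = A (y + z)" and A_scale: "scale c (A y) = A (scale c y)" for c y z
    by (simp_all add: A_def T.add T.scale scale_right_distrib scale_right_diff_distrib mult.commute)
  have eig: "\<exists>r. (T ^^ n) x = scale (\<alpha> ^ n) x + A r" for n
  proof (induction n)
    case 0
    show ?case by (rule exI[of _ 0]) (simp add: A_def T.zero)
  next
    case (Suc n)
    then obtain r where "(T ^^ n) x = scale (\<alpha> ^ n) x + A r" by blast
    then have "(T ^^ Suc n) x = scale (\<alpha> ^ n) (A x + scale \<alpha> x) + A (T r)"
      by (simp add: T.add T.scale A_T) (simp add: A_def)
    also have "\<dots> = scale (\<alpha> ^ Suc n) x + A (scale (\<alpha> ^ n) x + T r)"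
      by (simp add: scale_right_distrib A_scale mult.commute flip: A_add)
    finally show ?case by blast
  qed
  have cont_A: "continuous_on S A" for S
    unfolding A_def by (intro continuous_intros continuous_on_T continuous_on_scale)
  have "x \<in> closure (range A)"
  proof (rule ccontr)
    assume notin: "x \<notin> closure (range A)"
    define U where "U = {u. x - u \<in> - closure (range A)}"
    have "open U"
      unfolding U_def
      by (rule open_vimage[unfolded vimage_def]) (auto intro!: continuous_intros)
    moreover have "0 \<in> U"
      using notin by (simp add: U_def)
    ultimately obtain V where V: "open V" "0 \<in> V"
      "\<And>v c. v \<in> V \<Longrightarrow> cmod c \<le> 1 \<Longrightarrow> scale c v \<in> U"
      using absorbing_neighbourhood by meson
    \<comment> \<open>\<open>b x\<close> is the point that the orbit cannot approach: \<open>\<alpha> ^ n - b\<close> has modulus at least \<open>1\<close> for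
      all \<open>n\<close>, so dividing by it keeps vectors of \<open>V\<close> inside \<open>U\<close>.\<close>
    define b :: complex where "b = (if cmod \<alpha> \<ge> 1 then 0 else 2)"
    have far: "cmod (\<alpha> ^ n - b) \<ge> 1" for n
    proof (cases "cmod \<alpha> \<ge> 1")
      case True
      then show ?thesis by (simp add: b_def norm_power one_le_power)
    next
      case False
      then have "cmod (\<alpha> ^ n) \<le> 1" by (simp add: norm_power power_le_one)
      then show ?thesis
        using False norm_triangle_ineq2[of 2 "\<alpha> ^ n"] by (simp add: b_def norm_minus_commute)
    qed
    have "open {z. z - scale b x \<in> V}"
      by (rule open_vimage[unfolded vimage_def]) (auto intro!: V continuous_intros)
    moreover have "scale b x \<in> {z. z - scale b x \<in> V}"
      using V(2) by simp
    ultimately obtain n where "(T ^^ n) x - scale b x \<in> V"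
      using dense_orbit_visits[OF x] by blast
    moreover obtain r where r: "(T ^^ n) x = scale (\<alpha> ^ n) x + A r"
      using eig by blast
    ultimately have v: "scale (\<alpha> ^ n - b) x + A r \<in> V"
      by (simp add: scale_left_diff_distrib algebra_simps)
    define c where "c = inverse (\<alpha> ^ n - b)"
    have c: "c * (\<alpha> ^ n - b) = 1" "cmod c \<le> 1"
    proof -
      have "\<alpha> ^ n - b \<noteq> 0"
        using far[of n] by auto
      then show "c * (\<alpha> ^ n - b) = 1"
        by (simp add: c_def)
      show "cmod c \<le> 1"
        using far[of n] by (simp add: c_def norm_inverse inverse_le_1_iff)
    qed
    have "scale c (scale (\<alpha> ^ n - b) x + A r) \<in> U"
      using V(3)[OF v c(2)] .
    then have "x + A (scale c r) \<in> U"
      using c(1) by (simp add: scale_right_distrib A_scale)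
    then have "scale (- 1) (A (scale c r)) \<notin> closure (range A)"
      by (simp add: U_def)
    then show False
      using closure_subset[of "range A"] unfolding A_scale by blast
  qed
  moreover have "T z \<in> closure (range A)" if "z \<in> closure (range A)" for z
  proof -
    have "T ` closure (range A) \<subseteq> closure (range A)"
    proof (rule image_closure_subset)
      show "T ` range A \<subseteq> closure (range A)"
        using closure_subset[of "range A"] by (auto simp flip: A_T)
    qed (auto intro: continuous_on_subset[OF continuous_T])
    then show ?thesis using that by blast
  qed
  ultimately have "(T ^^ n) x \<in> closure (range A)" for n
    by (induction n) auto
  then have "closure (range (\<lambda>n. (T ^^ n) x)) \<subseteq> closure (range A)"
    by (intro closure_minimal) auto
  then show ?thesis
    using x by (auto simp: dense_orbit_def A_def)
qed

definition poly_op :: "complex poly \<Rightarrow> 'a \<Rightarrow> 'a" where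
  "poly_op p y = (\<Sum>i\<le>degree p. scale (coeff p i) ((T ^^ i) y))"

lemma poly_op_eq_sum:
  assumes "degree p \<le> N"
  shows "poly_op p y = (\<Sum>i\<le>N. scale (coeff p i) ((T ^^ i) y))"
  unfolding poly_op_def
  by (rule sum.mono_neutral_left) (use assms in \<open>auto simp: coeff_eq_0\<close>)

lemma poly_op_mult_linear_factor:
  "poly_op ([:- \<alpha>, 1:] * q) y = T (poly_op q y) - scale \<alpha> (poly_op q y)"
proof -
  let ?d = "degree q"
  have "degree ([:- \<alpha>, 1:] * q) \<le> Suc ?d"
    by (rule order_trans[OF degree_mult_le]) simp
  then have "poly_op ([:- \<alpha>, 1:] * q) y =
      (\<Sum>i\<le>Suc ?d. scale (coeff (pCons 0 q) i) ((T ^^ i) y)) -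
      (\<Sum>i\<le>Suc ?d. scale (\<alpha> * coeff q i) ((T ^^ i) y))"
    by (simp only: poly_op_eq_sum sum_subtractf[symmetric])
      (auto intro!: sum.cong simp: scale_left_diff_distrib)
  also have "(\<Sum>i\<le>Suc ?d. scale (\<alpha> * coeff q i) ((T ^^ i) y)) = scale \<alpha> (poly_op q y)"
    by (simp add: poly_op_eq_sum[of q "Suc ?d"] scale_sum_right del: sum.atMost_Suc)
  also have "(\<Sum>i\<le>Suc ?d. scale (coeff (pCons 0 q) i) ((T ^^ i) y)) = T (poly_op q y)"
    by (simp add: sum.atMost_Suc_shift poly_op_def T.sum T.scale del: sum.atMost_Suc)
  finally show ?thesis .
qed

text \<open>
  Over the complex numbers \<open>p\<close> splits into linear factors \<open>z - \<alpha>\<close>. Each \<open>T - \<alpha>\<close> has dense range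
  and commutes with \<open>T\<close>, hence preserves density of orbits.
\<close>
lemma dense_orbit_poly_op:
  assumes x: "dense_orbit x" and "p \<noteq> 0"
  shows "dense_orbit (poly_op p x)"
  using \<open>p \<noteq> 0\<close>
proof (induction "degree p" arbitrary: p)
  case 0
  then obtain c where c: "p = [:c:]" "c \<noteq> 0"
    by (metis degree_eq_zeroE pCons_eq_0_iff)
  have "dense_orbit (scale c x)"
  proof (rule dense_orbit_image[OF _ _ _ x])
    show "closure (range (scale c)) = UNIV"
    proof -
      have "z = scale c (scale (inverse c) z)" for z
        using c(2) by simp
      then have "range (scale c) = UNIV" by blast
      then show ?thesis by simp
    qed
  qed (auto intro!: continuous_on_scale continuous_intros simp: T.scale)
  then show ?case
    by (simp add: c poly_op_def)
next
  case (Suc d)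
  then have "\<not> constant (poly p)"
    by (simp add: constant_degree)
  then obtain z where "poly p z = 0"
    using fundamental_theorem_of_algebra by blast
  then obtain q where q: "p = [:- z, 1:] * q"
    by (auto simp: poly_eq_0_iff_dvd elim: dvdE)
  have "q \<noteq> 0"
    using Suc.prems q by auto
  then have "degree p = Suc (degree q)"
    unfolding q by (subst degree_mult_eq) auto
  then have IH: "dense_orbit (poly_op q x)"
    using Suc \<open>q \<noteq> 0\<close> by simp
  show ?case
    unfolding q poly_op_mult_linear_factor
    by (rule dense_orbit_image[OF _ dense_range_minus_scale[OF x] _ IH])
      (auto intro!: continuous_intros continuous_on_T continuous_on_scale simp: T.diff T.scale)
qed

lemma dense_orbit_combination:
  assumes x: "dense_orbit x" and "i \<le> N" "c i \<noteq> 0"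
  shows "dense_orbit (\<Sum>i\<le>N. scale (c i) ((T ^^ i) x))"
proof -
  define p where "p = (\<Sum>i\<le>N. monom (c i) i)"
  have coeff_p: "coeff p j = (if j \<le> N then c j else 0)" for j
    by (simp add: p_def coeff_sum)
  have "p \<noteq> 0"
    using assms(2,3) coeff_p[of i] by auto
  have "degree p \<le> N"
    by (rule degree_le) (simp add: coeff_p)
  then show ?thesis
    using dense_orbit_poly_op[OF x \<open>p \<noteq> 0\<close>] by (simp add: poly_op_eq_sum coeff_p)
qed

end

section \<open>The joint orbit in the product with the circle\<close>

text \<open>
  Together with a rotation by \<open>lam\<close>, the operator acts on the product of the space with the circle.
  The closure of the orbit of \<open>(y, 1)\<close> shows which angles occur while the orbit of \<open>y\<close>
  approaches a given vector.
\<close>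
locale circle_extension = complex_frechet_operator scale T
  for scale :: "complex \<Rightarrow> 'a::{real_vector, topological_ab_group_add} \<Rightarrow> 'a" and T +
  fixes lam :: complex
  assumes norm_lam: "cmod lam = 1"
begin

definition joint_closure :: "'a \<Rightarrow> ('a \<times> complex) set" where
  "joint_closure y = closure (range (\<lambda>n. ((T ^^ n) y, lam ^ n)))"

lemma closed_joint_closure: "closed (joint_closure y)"
  by (simp add: joint_closure_def)

lemma joint_closure_base: "(y, 1) \<in> joint_closure y"
proof -
  have "((T ^^ 0) y, lam ^ 0) \<in> joint_closure y"
    unfolding joint_closure_def by (rule subsetD[OF closure_subset]) blast
  then show ?thesis by simp
qed

lemma joint_closure_image:
  assumes "continuous_on UNIV f" "closed C" "\<And>n. f ((T ^^ n) y, lam ^ n) \<in> C"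
    and "p \<in> joint_closure y"
  shows "f p \<in> C"
proof -
  have "f ` joint_closure y \<subseteq> C"
    unfolding joint_closure_def
    by (rule image_closure_subset[OF continuous_on_subset[OF assms(1)] assms(2)])
      (use assms(3) in auto)
  then show ?thesis
    using assms(4) by blast
qed

lemma joint_closure_norm:
  assumes "(z, \<gamma>) \<in> joint_closure y"
  shows "cmod \<gamma> = 1"
proof -
  have "snd (z, \<gamma>) \<in> sphere 0 1"
    by (rule joint_closure_image[OF _ _ _ assms])
      (auto intro!: continuous_intros simp: norm_power norm_lam)
  then show ?thesis by simp
qed

lemma joint_closure_T:
  assumes "(z, \<gamma>) \<in> joint_closure y"
  shows "(T z, lam * \<gamma>) \<in> joint_closure y"
proof -
  have "(\<lambda>p. (T (fst p), lam * snd p)) (z, \<gamma>) \<in> joint_closure y"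
  proof (rule joint_closure_image[OF _ closed_joint_closure _ assms])
    show "continuous_on UNIV (\<lambda>p. (T (fst p), lam * snd p))"
      by (intro continuous_intros continuous_on_T)
    fix n
    have "((T ^^ Suc n) y, lam ^ Suc n) \<in> joint_closure y"
      unfolding joint_closure_def by (rule subsetD[OF closure_subset]) blast
    then show "(T (fst ((T ^^ n) y, lam ^ n)), lam * snd ((T ^^ n) y, lam ^ n)) \<in> joint_closure y"
      by simp
  qed
  then show ?thesis by simp
qed

lemma joint_closure_T_funpow:
  assumes "(z, \<gamma>) \<in> joint_closure y"
  shows "((T ^^ n) z, lam ^ n * \<gamma>) \<in> joint_closure y"
proof (induction n)
  case 0
  show ?case using assms by simp
next
  case (Suc n)
  then show ?case
    using joint_closure_T[OF Suc.IH] by (simp add: mult.assoc)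
qed

lemma joint_closure_trans:
  assumes "(z, \<gamma>) \<in> joint_closure y" "(w, \<delta>) \<in> joint_closure z"
  shows "(w, \<delta> * \<gamma>) \<in> joint_closure y"
proof -
  have "(\<lambda>p. (fst p, snd p * \<gamma>)) (w, \<delta>) \<in> joint_closure y"
    by (rule joint_closure_image[OF _ closed_joint_closure _ assms(2)])
      (auto intro!: continuous_intros joint_closure_T_funpow[OF assms(1)])
  then show ?thesis by simp
qed

lemma joint_closure_visits:
  assumes "(z, \<gamma>) \<in> joint_closure y" "open U" "z \<in> U" "e > 0"
  shows "\<exists>n. (T ^^ n) y \<in> U \<and> cmod (lam ^ n - \<gamma>) < e"
proof -
  have "open (U \<times> ball \<gamma> e)"
    using assms(2) by (intro open_Times) auto
  moreover have "(z, \<gamma>) \<in> U \<times> ball \<gamma> e"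
    using assms by auto
  ultimately have "range (\<lambda>n. ((T ^^ n) y, lam ^ n)) \<inter> (U \<times> ball \<gamma> e) \<noteq> {}"
    using assms(1) unfolding joint_closure_def closure_iff_nhds_not_empty by blast
  then show ?thesis
    by (auto simp: dist_norm norm_minus_commute)
qed

text \<open>
  Compactness of the circle: if no angle were possible over \<open>z\<close>, the tube lemma would give a
  neighbourhood of \<open>z\<close> that the orbit of \<open>y\<close> never enters.
\<close>
lemma joint_closure_nonempty:
  assumes y: "dense_orbit y"
  shows "\<exists>\<gamma>. (z, \<gamma>) \<in> joint_closure y"
proof (rule ccontr)
  assume none: "\<nexists>\<gamma>. (z, \<gamma>) \<in> joint_closure y"
  have "\<exists>U. open U \<and> z \<in> U \<and> (\<forall>u\<in>U. \<forall>\<gamma>\<in>sphere 0 1. (u, \<gamma>) \<notin> joint_closure y)"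
    by (rule closed_avoid_tube[OF closed_joint_closure]) (use none in auto)
  then obtain U where U: "open U" "z \<in> U"
    "\<And>u \<gamma>. u \<in> U \<Longrightarrow> \<gamma> \<in> sphere 0 1 \<Longrightarrow> (u, \<gamma>) \<notin> joint_closure y"
    by blast
  obtain n where n: "(T ^^ n) y \<in> U"
    using dense_orbit_visits[OF y U(1,2)] by blast
  have "((T ^^ n) y, lam ^ n) \<in> joint_closure y"
    unfolding joint_closure_def by (rule subsetD[OF closure_subset]) blast
  then show False
    using U(3)[OF n, of "lam ^ n"] by (simp add: norm_power norm_lam)
qed

text \<open>
  The angles that occur while the orbit of \<open>x\<close> returns to \<open>x\<close>.
\<close>
definition fibre :: "'a \<Rightarrow> complex set" where
  "fibre x = {\<gamma>. (x, \<gamma>) \<in> joint_closure x}"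

lemma fibre_cases: "fibre x = sphere 0 1 \<or> (\<exists>k\<ge>1. fibre x = {z. z ^ k = 1})"
proof (rule closed_circle_semigroup)
  have "fibre x = (\<lambda>\<gamma>. (x, \<gamma>)) -` joint_closure x"
    by (auto simp: fibre_def)
  then show "closed (fibre x)"
    by (simp add: closed_vimage closed_joint_closure continuous_on_Pair)
  show "fibre x \<subseteq> sphere 0 1"
    using joint_closure_norm by (auto simp: fibre_def)
  show "1 \<in> fibre x"
    by (simp add: fibre_def joint_closure_base)
  show "a * b \<in> fibre x" if "a \<in> fibre x" "b \<in> fibre x" for a b
    using joint_closure_trans[of x b x x a] that by (simp add: fibre_def)
qed

definition hat :: "real \<Rightarrow> nat \<Rightarrow> real" where
  "hat t i = max 0 (1 - \<bar>t - real i\<bar>)"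

text \<open>
  The hat functions make the sum for \<open>s = 0\<close> into the path that runs through the orbit of \<open>x\<close>,
  reaching \<open>(T ^^ n) x\<close> at time \<open>n\<close> along straight segments; the parameter \<open>s\<close> contracts this path
  linearly to \<open>x\<close>. For \<open>s \<in> {0..1}\<close> and \<open>t \<in> {0..N}\<close> the coefficients are nonnegative and do not all
  vanish, so the value is a nonzero polynomial in \<open>T\<close> applied to \<open>x\<close> and again has dense orbit.
\<close>
definition orbit_cone :: "'a \<Rightarrow> nat \<Rightarrow> real \<times> real \<Rightarrow> 'a" where
  "orbit_cone x N = (\<lambda>(s, t). \<Sum>i\<le>N.
     scale (complex_of_real ((1 - s) * hat t i + (if i = 0 then s else 0))) ((T ^^ i) x))"

lemma continuous_on_orbit_cone: "continuous_on S (orbit_cone x N)"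
  unfolding orbit_cone_def hat_def case_prod_beta
proof (intro continuous_on_sum continuous_on_scale continuous_intros)
  show "continuous_on S (\<lambda>p. if i = 0 then fst p else 0)" for i :: nat
    by (cases "i = 0") (auto intro!: continuous_intros)
qed

lemma dense_orbit_orbit_cone:
  assumes x: "dense_orbit x" and s: "s \<in> {0..1}" and t: "t \<in> {0..real N}"
  shows "dense_orbit (orbit_cone x N (s, t))"
proof -
  let ?c = "\<lambda>i. (1 - s) * hat t i + (if i = 0 then s else 0)"
  have "\<exists>i\<le>N. ?c i \<noteq> 0"
  proof (cases "s = 1")
    case True
    then show ?thesis by (intro exI[of _ 0]) simp
  next
    case False
    define i where "i = nat \<lfloor>t\<rfloor>"
    have i: "real i \<le> t" "t < real i + 1"
      using t by (auto simp: i_def)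
    then have "i \<le> N"
      using t by simp
    moreover have "(1 - s) * hat t i > 0"
      using i s False by (intro mult_pos_pos) (auto simp: hat_def)
    then have "?c i > 0"
      using s by auto
    ultimately show ?thesis by (metis less_irrefl)
  qed
  then obtain i where "i \<le> N" "?c i \<noteq> 0" by blast
  then show ?thesis
    using dense_orbit_combination[OF x, of i N "\<lambda>i. complex_of_real (?c i)"]
    by (simp add: orbit_cone_def del: of_real_add of_real_mult)
qed

lemma orbit_cone_at_integer:
  assumes "n \<le> N"
  shows "orbit_cone x N (s, real n) =
    scale (complex_of_real (1 - s)) ((T ^^ n) x) + scale (complex_of_real s) x"
proof -
  have hat: "hat (real n) i = (if i = n then 1 else 0)" for i
    by (cases i n rule: linorder_cases) (auto simp: hat_def)
  have "orbit_cone x N (s, real n) = (\<Sum>i\<le>N.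
      (if i = n then scale (complex_of_real (1 - s)) ((T ^^ n) x) else 0) +
      (if i = 0 then scale (complex_of_real s) x else 0))"
    unfolding orbit_cone_def prod.case
    by (rule sum.cong) (auto simp: hat scale_left_distrib)
  then show ?thesis
    using assms by (simp add: sum.distrib)
qed

lemma orbit_cone_time_zero: "orbit_cone x N (s, 0) = x"
  using orbit_cone_at_integer[of 0 N x s] by (simp flip: scale_left_distrib of_real_add)

lemma orbit_cone_apex: "orbit_cone x N (1, t) = x"
proof -
  have "orbit_cone x N (1, t) = (\<Sum>i\<le>N. if i = 0 then x else 0)"
    unfolding orbit_cone_def prod.case by (rule sum.cong) auto
  then show ?thesis by simp
qed

lemma orbit_cone_shift:
  assumes t: "0 \<le> t" "t + 1 \<le> real N"
  shows "orbit_cone x N (0, t + 1) = T (orbit_cone x N (0, t))"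
proof -
  obtain M where N: "N = Suc M"
    using t by (cases N) auto
  have ends: "hat (t + 1) 0 = 0" "hat t (Suc M) = 0"
    using t by (auto simp: hat_def N)
  have shift: "hat (t + 1) (Suc i) = hat t i" for i
    by (simp add: hat_def)
  have "orbit_cone x N (0, t + 1) = (\<Sum>i\<le>M. scale (complex_of_real (hat t i)) ((T ^^ Suc i) x))"
    unfolding orbit_cone_def prod.case N
    by (simp add: sum.atMost_Suc_shift ends shift del: sum.atMost_Suc)
  moreover have "orbit_cone x N (0, t) = (\<Sum>i\<le>M. scale (complex_of_real (hat t i)) ((T ^^ i) x))"
    unfolding orbit_cone_def prod.case N by (simp add: ends)
  ultimately show ?thesis
    by (simp add: T.sum T.scale)
qed

text \<open>
  If the fibre over \<open>x\<close> is not the whole circle, it consists of the \<open>k\<close>-th roots of unity.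
  Then for every vector \<open>y\<close> with dense orbit all angles \<open>\<gamma>\<close> over \<open>y\<close> have the same power \<open>\<gamma> ^ k\<close>: a passage from \<open>y\<close> back to
  \<open>x\<close> turns them into elements of the fibre. This power is a continuous function \<open>\<phi>\<close> of \<open>y\<close> with
  \<open>\<phi> (T y) = lam ^ k * \<phi> y\<close>. When \<open>(T ^^ N) x\<close> is near \<open>x\<close>, the function \<open>\<phi>\<close> on the cone over
  the orbit path up to time \<open>N\<close> satisfies the conditions of the winding argument, so \<open>lam ^ k\<close> has a
  logarithm of modulus at most \<open>pi / N\<close>. As \<open>N\<close> can be arbitrarily large, \<open>lam ^ k = 1\<close>.
\<close>
lemma lam_in_fibre:
  assumes x: "dense_orbit x"
    and rec: "\<And>U. open U \<Longrightarrow> x \<in> U \<Longrightarrow> infinite (return_set T x U)"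
  shows "lam \<in> fibre x"
proof -
  consider "fibre x = sphere 0 1" | k where "k \<ge> 1" "fibre x = {z. z ^ k = 1}"
    using fibre_cases by blast
  then show ?thesis
  proof cases
    case 1
    then show ?thesis by (simp add: norm_lam)
  next
    case (2 k)
    define \<phi> where "\<phi> y = (SOME \<gamma>. (y, \<gamma>) \<in> joint_closure x) ^ k" for y
    have \<phi>_eq: "\<phi> y = \<gamma> ^ k" if y: "dense_orbit y" and \<gamma>: "(y, \<gamma>) \<in> joint_closure x" for y \<gamma>
    proof -
      define \<gamma>' where "\<gamma>' = (SOME \<gamma>. (y, \<gamma>) \<in> joint_closure x)"
      have \<gamma>': "(y, \<gamma>') \<in> joint_closure x"
        unfolding \<gamma>'_def by (rule someI) (rule \<gamma>)
      obtain \<beta> where \<beta>: "(x, \<beta>) \<in> joint_closure y"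
        using joint_closure_nonempty[OF y] by blast
      have "\<beta> * \<gamma> \<in> fibre x" "\<beta> * \<gamma>' \<in> fibre x"
        using joint_closure_trans[OF \<gamma> \<beta>] joint_closure_trans[OF \<gamma>' \<beta>] by (auto simp: fibre_def)
      then have "\<beta> ^ k * \<gamma> ^ k = \<beta> ^ k * \<gamma>' ^ k"
        by (simp add: 2 power_mult_distrib)
      moreover have "\<beta> \<noteq> 0"
        using joint_closure_norm[OF \<beta>] by auto
      ultimately show ?thesis
        by (simp add: \<phi>_def \<gamma>'_def)
    qed
    have \<phi>_norm: "cmod (\<phi> y) = 1" if "dense_orbit y" for y
      using joint_closure_nonempty[OF x, of y] \<phi>_eq[OF that] joint_closure_norm
      by (metis norm_power power_one)
    have \<phi>_x: "\<phi> x = 1"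
      using \<phi>_eq[OF x joint_closure_base] by simp
    have \<phi>_T: "\<phi> (T y) = lam ^ k * \<phi> y" if "dense_orbit y" "dense_orbit (T y)" for y
    proof -
      obtain \<gamma> where \<gamma>: "(y, \<gamma>) \<in> joint_closure x"
        using joint_closure_nonempty[OF x] by blast
      then show ?thesis
        using \<phi>_eq[OF that(1) \<gamma>] \<phi>_eq[OF that(2) joint_closure_T[OF \<gamma>]]
        by (simp add: power_mult_distrib)
    qed
    have \<phi>_cont: "\<exists>U. open U \<and> y \<in> U \<and> (\<forall>z\<in>U. dense_orbit z \<longrightarrow> cmod (\<phi> z - \<phi> y) < e)"
      if y: "dense_orbit y" and e: "e > 0" for y e
    proof -
      let ?C = "joint_closure x \<inter> {p. e \<le> cmod (snd p ^ k - \<phi> y)}"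
      have "\<exists>U. open U \<and> y \<in> U \<and> (\<forall>u\<in>U. \<forall>\<gamma>\<in>sphere 0 1. (u, \<gamma>) \<notin> ?C)"
      proof (rule closed_avoid_tube)
        show "closed ?C"
          by (intro closed_Int closed_joint_closure closed_Collect_le continuous_intros)
        show "(y, \<gamma>) \<notin> ?C" for \<gamma>
          using \<phi>_eq[OF y] e by auto
      qed simp
      then obtain U where U: "open U" "y \<in> U"
        "\<And>u \<gamma>. u \<in> U \<Longrightarrow> cmod \<gamma> = 1 \<Longrightarrow> (u, \<gamma>) \<notin> ?C"
        by auto
      have "cmod (\<phi> z - \<phi> y) < e" if z: "z \<in> U" "dense_orbit z" for z
      proof -
        obtain \<gamma> where \<gamma>: "(z, \<gamma>) \<in> joint_closure x"
          using joint_closure_nonempty[OF x] by blast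
        then have "\<not> e \<le> cmod (\<gamma> ^ k - \<phi> y)"
          using U(3)[OF z(1) joint_closure_norm[OF \<gamma>]] by simp
        then show ?thesis
          using \<phi>_eq[OF z(2) \<gamma>] by simp
      qed
      with U show ?thesis by blast
    qed
    obtain U where U: "open U" "x \<in> U" "\<And>z. z \<in> U \<Longrightarrow> dense_orbit z \<Longrightarrow> cmod (\<phi> z - 1) < 1"
      using \<phi>_cont[OF x, of 1] \<phi>_x by auto
    have "open {v. x + v \<in> U}"
      by (rule open_vimage[unfolded vimage_def]) (auto intro!: U continuous_intros)
    then obtain V where V: "open V" "convex V" "0 \<in> V" "V \<subseteq> {v. x + v \<in> U}"
      using locally_convex[of "{v. x + v \<in> U}"] U(2) by auto
    have logarithm: "\<exists>c. exp c = lam ^ k \<and> real N * cmod c \<le> pi"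
      if N: "N \<ge> 1" "(T ^^ N) x - x \<in> V" for N
    proof (rule circle_lift_shift[where f = "\<lambda>p. \<phi> (orbit_cone x N p)"])
      let ?K = "{0..1::real} \<times> {0..real N}"
      have dense: "dense_orbit (orbit_cone x N p)" if "p \<in> ?K" for p
        using dense_orbit_orbit_cone[OF x] that by (cases p) auto
      show "continuous_on ?K (\<lambda>p. \<phi> (orbit_cone x N p))"
        unfolding continuous_on_def
      proof (intro ballI tendstoI)
        fix p and e :: real assume p: "p \<in> ?K" and e: "e > 0"
        obtain W where W: "open W" "orbit_cone x N p \<in> W"
          "\<And>z. z \<in> W \<Longrightarrow> dense_orbit z \<Longrightarrow> cmod (\<phi> z - \<phi> (orbit_cone x N p)) < e"
          using \<phi>_cont[OF dense[OF p] e] by blast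
        have "(orbit_cone x N \<longlongrightarrow> orbit_cone x N p) (at p within ?K)"
          using continuous_on_orbit_cone[of ?K x N] p unfolding continuous_on_def by blast
        then have "\<forall>\<^sub>F q in at p within ?K. orbit_cone x N q \<in> W"
          using W(1,2) by (rule topological_tendstoD)
        moreover have "\<forall>\<^sub>F q in at p within ?K. q \<in> ?K"
          by (auto simp: eventually_at_filter)
        ultimately show "\<forall>\<^sub>F q in at p within ?K.
            dist (\<phi> (orbit_cone x N q)) (\<phi> (orbit_cone x N p)) < e"
          by eventually_elim (use W(3) dense in \<open>simp add: dist_norm\<close>)
      qed
      show "cmod (\<phi> (orbit_cone x N (s, t))) = 1" if "s \<in> {0..1}" "t \<in> {0..real N}" for s t
        using \<phi>_norm dense that by auto
      show "\<phi> (orbit_cone x N (0, t + 1)) = lam ^ k * \<phi> (orbit_cone x N (0, t))"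
        if "0 \<le> t" "t + 1 \<le> real N" for t
        using \<phi>_T[of "orbit_cone x N (0, t)"] dense[of "(0, t)"] dense[of "(0, t + 1)"] that
        by (simp add: orbit_cone_shift)
      show "\<phi> (orbit_cone x N (s, 0)) = 1" for s
        by (simp add: orbit_cone_time_zero \<phi>_x)
      show "\<phi> (orbit_cone x N (1, t)) = 1" for t
        by (simp add: orbit_cone_apex \<phi>_x)
      show "0 < Re (\<phi> (orbit_cone x N (s, real N)))" if s: "s \<in> {0..1}" for s
      proof -
        have "(1 - s) *\<^sub>R ((T ^^ N) x - x) + s *\<^sub>R 0 \<in> V"
          using s by (intro convexD[OF V(2)] N V(3)) auto
        then have "x + (1 - s) *\<^sub>R ((T ^^ N) x - x) \<in> U"
          using V(4) by auto
        moreover have "orbit_cone x N (s, real N) = x + (1 - s) *\<^sub>R ((T ^^ N) x - x)"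
          by (simp only: orbit_cone_at_integer[OF order_refl] scale_of_real) (simp add: algebra_simps)
        ultimately have "cmod (\<phi> (orbit_cone x N (s, real N)) - 1) < 1"
          using U(3) dense[of "(s, real N)"] s by simp
        then show ?thesis
          using abs_Re_le_cmod[of "\<phi> (orbit_cone x N (s, real N)) - 1"] by simp
      qed
      show "N \<ge> 1" by fact
    qed
    have "lam ^ k = 1"
    proof (rule ccontr)
      assume "lam ^ k \<noteq> 1"
      then have "cmod (lam ^ k - 1) > 0" by simp
      moreover have "isCont exp (0::complex)" by simp
      ultimately obtain d where d: "d > 0" "\<And>c. cmod c < d \<Longrightarrow> cmod (exp c - 1) < cmod (lam ^ k - 1)"
        unfolding continuous_at_eps_delta dist_norm by (metis diff_zero exp_zero)
      have "open {z. z - x \<in> V}"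
        by (rule open_vimage[unfolded vimage_def]) (auto intro!: V continuous_intros)
      then have "infinite (return_set T x {z. z - x \<in> V})"
        using rec V(3) by simp
      then obtain N where N: "N > nat \<lceil>pi / d\<rceil>" "(T ^^ N) x - x \<in> V"
        unfolding infinite_nat_iff_unbounded by (auto simp: return_set_def)
      obtain c where c: "exp c = lam ^ k" "real N * cmod c \<le> pi"
        using logarithm[of N] N by auto
      have "pi / d < real N"
        using N(1) by linarith
      then have "pi < real N * d"
        using d(1) by (simp add: field_simps)
      then have "real N * cmod c < real N * d"
        using c(2) by simp
      then have "cmod c < d"
        by (simp add: mult_less_cancel_left)
      then show False
        using d(2)[of c] c(1) by simp
    qed
    then show ?thesis
      using 2 by simp
  qed
qed

text \<open>
  Since \<open>lam\<close>, and hence each of its powers, occurs as an angle of return to \<open>x\<close>, the angle picked up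
  on the way from \<open>x\<close> into \<open>U\<close> can be compensated by returning to \<open>x\<close> first. For \<open>lam\<close> a root of
  unity this contains Ansari's theorem on powers, and in general the theorem of Leon-Saavedra and
  Mueller on rotations.
\<close>
lemma visits_near_one:
  assumes vis: "\<And>U. open U \<Longrightarrow> U \<noteq> {} \<Longrightarrow> infinite (return_set T x U)"
    and U: "open U" "U \<noteq> {}" and e: "e > 0"
  shows "\<exists>n. (T ^^ n) x \<in> U \<and> cmod (lam ^ n - 1) < e"
proof -
  have "z \<in> closure (range (\<lambda>n. (T ^^ n) x))" for z
    unfolding closure_iff_nhds_not_empty
  proof (intro allI impI)
    fix A W assume "W \<subseteq> A" "z \<in> W" "open W"
    moreover from this have "return_set T x W \<noteq> {}"
      using vis[of W] by (metis empty_iff finite.emptyI)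
    ultimately show "range (\<lambda>n. (T ^^ n) x) \<inter> A \<noteq> {}"
      by (auto simp: return_set_def)
  qed
  then have x: "dense_orbit x"
    by (auto simp: dense_orbit_def)
  have lam: "(x, lam) \<in> joint_closure x"
    using lam_in_fibre[OF x] vis by (auto simp: fibre_def)
  have pow: "(x, lam ^ n) \<in> joint_closure x" for n
  proof (induction n)
    case 0
    show ?case by (simp add: joint_closure_base)
  next
    case (Suc n)
    show ?case
      using joint_closure_trans[OF Suc lam] by simp
  qed
  obtain m where m: "(T ^^ m) x \<in> U"
    using dense_orbit_visits[OF x U(1)] U(2) by blast
  obtain q where q: "q \<ge> 1" "cmod ((lam ^ m) ^ q - 1) < e / 2"
    using unit_power_near_one[of "lam ^ m" "e / 2"] e by (auto simp: norm_power norm_lam)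
  have "((T ^^ m) x, lam ^ m * lam ^ (m * (q - 1))) \<in> joint_closure x"
    by (rule joint_closure_T_funpow[OF pow])
  moreover have "lam ^ m * lam ^ (m * (q - 1)) = (lam ^ m) ^ q"
    using q(1) by (cases q) (simp_all add: power_mult)
  ultimately obtain n where n: "(T ^^ n) x \<in> U" "cmod (lam ^ n - (lam ^ m) ^ q) < e / 2"
    using joint_closure_visits[OF _ U(1) m, of _ x "e / 2"] e by auto
  have "cmod (lam ^ n - 1) < e"
    using norm_triangle_lt[of "lam ^ n - (lam ^ m) ^ q" "(lam ^ m) ^ q - 1" e] n(2) q(2) by simp
  with n(1) show ?thesis by blast
qed

end

section \<open>Arithmetic progressions of return times\<close>

lemma AP_mono: "A \<in> AP \<Longrightarrow> A \<subseteq> B \<Longrightarrow> B \<in> AP"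
  unfolding AP_def by blast

lemma AP_infinite:
  assumes "A \<in> AP"
  shows "infinite A"
  unfolding infinite_nat_iff_unbounded_le
proof
  fix m
  obtain a k where "k \<ge> 1" "\<forall>j\<le>m. a + j * k \<in> A"
    using assms unfolding AP_def by blast
  moreover from this have "m \<le> a + m * k"
    by (simp add: trans_le_add2)
  ultimately show "\<exists>n\<ge>m. n \<in> A" by blast
qed

lemma AP_multiple:
  assumes "A \<in> AP" "p \<ge> 1" "\<And>n. n \<in> A \<Longrightarrow> p * n \<in> B"
  shows "B \<in> AP"
  unfolding AP_def
proof (intro CollectI allI)
  fix m
  obtain a k where k: "k \<ge> 1" "\<forall>j\<le>m. a + j * k \<in> A"
    using assms(1) unfolding AP_def by blast
  have "p * a + j * (p * k) \<in> B" if "j \<le> m" for j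
    using assms(3)[of "a + j * k"] k(2) that by (simp add: algebra_simps)
  then show "\<exists>a k. k \<ge> 1 \<and> (\<forall>j\<le>m. a + j * k \<in> B)"
    using k(1) assms(2) by (intro exI[of _ "p * a"] exI[of _ "p * k"]) auto
qed

lemma AP_quotient:
  assumes "{n \<in> A. p dvd n} \<in> AP" "p \<ge> 1"
  shows "{n. p * n \<in> A} \<in> AP"
  unfolding AP_def
proof (intro CollectI allI)
  fix m
  \<comment> \<open>Two terms of the progression force \<open>p dvd k\<close>, hence \<open>Suc m\<close> in place of \<open>m\<close>.\<close>
  obtain a k where k: "k \<ge> 1" "\<forall>j\<le>Suc m. a + j * k \<in> A \<and> p dvd a + j * k"
    using assms(1) unfolding AP_def by blast
  have a: "p dvd a"
    using k(2) by (metis add_0_right le0 mult_0)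
  moreover have "p dvd a + 1 * k"
    using k(2) by (metis One_nat_def Suc_le_mono le0)
  ultimately have "p dvd k"
    by (simp add: dvd_add_right_iff)
  with a obtain b l where bl: "a = p * b" "k = p * l"
    by (auto elim!: dvdE)
  have "b + j * l \<in> {n. p * n \<in> A}" if "j \<le> m" for j
    using k(2) that by (auto simp: bl algebra_simps dest: spec[of _ j])
  moreover have "l \<ge> 1"
    using k(1) bl(2) by (cases l) auto
  ultimately show "\<exists>a k. k \<ge> 1 \<and> (\<forall>j\<le>m. a + j * k \<in> {n. p * n \<in> A})"
    by blast
qed

text \<open>
  Two corrections turn a progression in a return set into one along which \<open>lam ^ n\<close> is near \<open>1\<close>.
  Passing to a subprogression with \<open>q\<close> times the difference makes \<open>lam ^ n\<close> almost constant.
  To make the constant almost \<open>1\<close>, translate by one of finitely many times \<open>j s\<close>, with \<open>s\<close> chosen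
  according to the initial term: these times bring \<open>x\<close> into \<open>U\<close> with angle near \<open>lam ^ s\<close>, so one
  neighbourhood \<open>W\<close> of \<open>x\<close> is carried into \<open>U\<close> by all of them, and the progression is sought among
  the returns to \<open>W\<close>.
\<close>
lemma (in circle_extension) AP_return_near_one:
  assumes x: "AP_hypercyclic_vector T x" and U: "open U" "U \<noteq> {}" and e: "e > 0"
  shows "{n \<in> return_set T x U. cmod (lam ^ n - 1) < e} \<in> AP"
  unfolding AP_def
proof (intro CollectI allI)
  fix m
  have vis: "infinite (return_set T x W)" if "open W" "W \<noteq> {}" for W
    using x that AP_infinite by (auto simp: AP_hypercyclic_vector_def)
  have landing: "\<exists>j. (T ^^ j) x \<in> U \<and> cmod (lam ^ j - lam ^ s) < e / 4" for s
  proof -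
    let ?W = "{z. (T ^^ s) z \<in> U}"
    have W: "open ?W"
      by (rule open_vimage[unfolded vimage_def]) (auto intro!: U continuous_on_T_funpow continuous_intros)
    obtain n where "n \<ge> s" "(T ^^ n) x \<in> U"
      using vis[OF U] unfolding infinite_nat_iff_unbounded_le by (auto simp: return_set_def)
    then have "(T ^^ (n - s)) x \<in> ?W"
      by (simp flip: funpow_add[unfolded o_def, THEN fun_cong])
    then obtain n' where n': "(T ^^ n') x \<in> ?W" "cmod (lam ^ n' - 1) < e / 4"
      using visits_near_one[OF vis W, of "e / 4"] e by auto
    have "lam ^ (s + n') - lam ^ s = lam ^ s * (lam ^ n' - 1)"
      by (simp add: power_add right_diff_distrib)
    then have "cmod (lam ^ (s + n') - lam ^ s) < e / 4"
      using n'(2) by (simp add: norm_mult norm_power norm_lam)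
    moreover have "(T ^^ (s + n')) x \<in> U"
      using n'(1) by (simp add: funpow_add)
    ultimately show ?thesis by blast
  qed
  then obtain j where j: "\<And>s. (T ^^ j s) x \<in> U" "\<And>s. cmod (lam ^ j s - lam ^ s) < e / 4"
    by metis
  obtain F where F: "finite F" "\<And>n. \<exists>s\<in>F. cmod (lam ^ (n + s) - 1) < e / 2"
    using unit_orbit_finite_return[OF norm_lam, of "e / 2"] e by auto
  define W where "W = (\<Inter>s\<in>F. {z. (T ^^ j s) z \<in> U})"
  have "open W"
    unfolding W_def
    by (intro open_INT F ballI open_vimage[unfolded vimage_def])
      (auto intro!: U continuous_on_T_funpow continuous_intros)
  moreover have "x \<in> W"
    by (simp add: W_def j)
  ultimately have W: "return_set T x W \<in> AP"
    using x by (auto simp: AP_hypercyclic_vector_def)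
  \<comment> \<open>The error \<open>\<delta>\<close> of a single step accumulates over at most \<open>m\<close> steps.\<close>
  define \<delta> where "\<delta> = e / (4 * real (Suc m))"
  have \<delta>: "\<delta> > 0" "real m * \<delta> \<le> e / 4"
    using e by (auto simp: \<delta>_def field_simps)
  obtain Q where Q: "\<And>z. cmod z = 1 \<Longrightarrow> \<exists>q. 1 \<le> q \<and> q \<le> Q \<and> cmod (z ^ q - 1) < \<delta>"
    using unit_power_near_one_uniform[OF \<delta>(1)] by blast
  \<comment> \<open>The factor \<open>Q\<close> leaves room for multiplying the difference by any \<open>q \<le> Q\<close>.\<close>
  obtain a k where k: "k \<ge> 1" "\<And>i. i \<le> m * Q \<Longrightarrow> (T ^^ (a + i * k)) x \<in> W"
    using W unfolding AP_def return_set_def by blast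
  obtain q where q: "1 \<le> q" "q \<le> Q" "cmod ((lam ^ k) ^ q - 1) < \<delta>"
    using Q[of "lam ^ k"] by (auto simp: norm_power norm_lam)
  obtain s where s: "s \<in> F" "cmod (lam ^ (a + s) - 1) < e / 2"
    using F(2) by blast
  have "(a + j s) + i * (q * k) \<in> {n \<in> return_set T x U. cmod (lam ^ n - 1) < e}" if i: "i \<le> m" for i
  proof -
    have "(T ^^ (a + (i * q) * k)) x \<in> W"
      using i q(2) by (intro k(2) mult_le_mono) auto
    then have "(T ^^ j s) ((T ^^ (a + (i * q) * k)) x) \<in> U"
      using s(1) by (auto simp: W_def)
    moreover have "(T ^^ j s) ((T ^^ (a + (i * q) * k)) x) = (T ^^ ((a + j s) + i * (q * k))) x"
      by (simp add: ac_simps flip: funpow_add[unfolded o_def, THEN fun_cong])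
    ultimately have inU: "(T ^^ ((a + j s) + i * (q * k))) x \<in> U"
      by simp
    let ?z = "(lam ^ k) ^ q"
    have "cmod (?z ^ i - 1) \<le> real i * cmod (?z - 1)"
      by (rule unit_power_diff) (simp add: norm_power norm_lam)
    also have "\<dots> \<le> real m * \<delta>"
      using i q(3) by (intro mult_mono) auto
    finally have z: "cmod (?z ^ i - 1) \<le> e / 4"
      using \<delta>(2) by linarith
    have "lam ^ ((a + j s) + i * (q * k)) - 1 =
        lam ^ (a + j s) * (?z ^ i - 1) + (lam ^ a * (lam ^ j s - lam ^ s) + (lam ^ (a + s) - 1))"
      by (simp add: algebra_simps power_add flip: power_mult)
    also have "cmod \<dots> \<le> cmod (?z ^ i - 1) + (cmod (lam ^ j s - lam ^ s) + cmod (lam ^ (a + s) - 1))"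
      by (intro order_trans[OF norm_triangle_ineq] add_mono)
        (simp_all add: norm_mult norm_power norm_lam)
    also have "\<dots> < e"
      using z j(2)[of s] s(2) by linarith
    finally show ?thesis
      using inU by (simp add: return_set_def)
  qed
  moreover have "q * k \<ge> 1"
    using q(1) k(1) by simp
  ultimately show "\<exists>a k. k \<ge> 1 \<and>
      (\<forall>i\<le>m. a + i * k \<in> {n \<in> return_set T x U. cmod (lam ^ n - 1) < e})"
    by blast
qed

context complex_frechet_operator
begin

lemma AP_hypercyclic_vector_funpow:
  assumes x: "AP_hypercyclic_vector T x" and p: "p \<ge> 1"
  shows "AP_hypercyclic_vector (T ^^ p) x"
  unfolding AP_hypercyclic_vector_def
proof (intro allI impI)
  fix U :: "'a set" assume U: "open U \<and> U \<noteq> {}"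
  obtain z e where z: "cmod z = 1" "e > 0" "\<And>n. cmod (z ^ n - 1) < e \<Longrightarrow> p dvd n"
    using root_of_unity_gap[OF p] by blast
  interpret circle_extension scale T z
    by unfold_locales (rule z(1))
  have "{n \<in> return_set T x U. cmod (z ^ n - 1) < e} \<in> AP"
    using AP_return_near_one[OF x] U z(2) by blast
  then have "{n \<in> return_set T x U. p dvd n} \<in> AP"
    by (rule AP_mono) (use z(3) in auto)
  then have "{n. p * n \<in> return_set T x U} \<in> AP"
    using p by (rule AP_quotient)
  then show "return_set (T ^^ p) x U \<in> AP"
    by (simp add: return_set_def funpow_mult mult.commute)
qed

lemma funpow_scaled: "((\<lambda>y. scale \<mu> (T y)) ^^ n) y = scale (\<mu> ^ n) ((T ^^ n) y)"
  by (induction n) (simp_all add: T.scale mult.commute)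

lemma AP_hypercyclic_vector_rotation:
  assumes x: "AP_hypercyclic_vector T x" and \<mu>: "cmod \<mu> = 1"
  shows "AP_hypercyclic_vector (\<lambda>y. scale \<mu> (T y)) x"
  unfolding AP_hypercyclic_vector_def
proof (intro allI impI)
  fix U :: "'a set" assume U: "open U \<and> U \<noteq> {}"
  then obtain u where u: "u \<in> U" by blast
  have "open {q. scale (fst q) (snd q) \<in> U}"
    by (rule open_vimage[unfolded vimage_def])
      (use U in \<open>auto intro!: continuous_on_scale continuous_intros\<close>)
  then obtain A B where AB: "open A" "open B" "1 \<in> A" "u \<in> B"
    "A \<times> B \<subseteq> {q. scale (fst q) (snd q) \<in> U}"
    by (rule open_prod_elim[of _ "(1, u)"]) (use u in auto)
  obtain e where e: "e > 0" "ball 1 e \<subseteq> A"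
    using AB(1,3) open_contains_ball by blast
  interpret circle_extension scale T \<mu>
    by unfold_locales (rule \<mu>)
  have "{n \<in> return_set T x B. cmod (\<mu> ^ n - 1) < e} \<in> AP"
    using AP_return_near_one[OF x AB(2) _ e(1)] AB(4) by blast
  then show "return_set (\<lambda>y. scale \<mu> (T y)) x U \<in> AP"
  proof (rule AP_mono, safe)
    fix n assume n: "n \<in> return_set T x B" "cmod (\<mu> ^ n - 1) < e"
    then have "\<mu> ^ n \<in> A"
      using e(2) by (auto simp: dist_norm norm_minus_commute)
    then have "(\<mu> ^ n, (T ^^ n) x) \<in> A \<times> B"
      using n(1) by (simp add: return_set_def)
    then show "n \<in> return_set (\<lambda>y. scale \<mu> (T y)) x U"
      using AB(5) by (auto simp: return_set_def funpow_scaled)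
  qed
qed

lemma complex_frechet_operator_scaled:
  "complex_frechet_operator scale (\<lambda>y. scale \<mu> (T y))"
proof (intro complex_frechet_operator.intro complex_frechet_operator_axioms.intro
    complex_frechet_space_axioms)
  show "Vector_Spaces.linear scale scale (\<lambda>y. scale \<mu> (T y))"
    by unfold_locales (simp_all add: T.add T.scale scale_right_distrib mult.commute)
  show "continuous_on UNIV (\<lambda>y. scale \<mu> (T y))"
    by (intro continuous_on_scale continuous_on_T continuous_intros)
qed

end

lemma AP_hypercyclic_vector_of_funpow:
  fixes T :: "'a::topological_space \<Rightarrow> 'a"
  assumes "AP_hypercyclic_vector (T ^^ p) x" "p \<ge> 1"
  shows "AP_hypercyclic_vector T x"
  unfolding AP_hypercyclic_vector_def
proof (intro allI impI)
  fix U :: "'a set" assume "open U \<and> U \<noteq> {}"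
  then have "return_set (T ^^ p) x U \<in> AP"
    using assms(1) by (auto simp: AP_hypercyclic_vector_def)
  then show "return_set T x U \<in> AP"
    using assms(2) by (rule AP_multiple) (simp add: return_set_def funpow_mult mult.commute)
qed

theorem proposition2p5:
  fixes scale :: "complex \<Rightarrow> 'a::{real_vector, topological_ab_group_add} \<Rightarrow> 'a"
    and T :: "'a \<Rightarrow> 'a"
  assumes "complex_frechet_space scale"
    and "Vector_Spaces.linear scale scale T"
    and "continuous_on UNIV T"
    and "AP_hypercyclic T"
  shows "(\<forall>p\<ge>1. AP_hypercyclic (T ^^ p)) \<and>
    (\<forall>\<mu>. cmod \<mu> = 1 \<longrightarrow> AP_hypercyclic (\<lambda>x. scale \<mu> (T x))) \<and>
    (\<forall>p\<ge>1. {x. AP_hypercyclic_vector (T ^^ p) x} = {x. AP_hypercyclic_vector T x}) \<and>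
    (\<forall>\<mu>. cmod \<mu> = 1 \<longrightarrow>
      {x. AP_hypercyclic_vector (\<lambda>x. scale \<mu> (T x)) x} = {x. AP_hypercyclic_vector T x})"
proof -
  interpret complex_frechet_operator scale T
    using assms(1-3) by (intro complex_frechet_operator.intro complex_frechet_operator_axioms.intro)
  have powers: "AP_hypercyclic_vector (T ^^ p) x \<longleftrightarrow> AP_hypercyclic_vector T x" if "p \<ge> 1" for p x
    using AP_hypercyclic_vector_funpow AP_hypercyclic_vector_of_funpow that by blast
  have rotations: "AP_hypercyclic_vector (\<lambda>y. scale \<mu> (T y)) x \<longleftrightarrow> AP_hypercyclic_vector T x"
    if \<mu>: "cmod \<mu> = 1" for \<mu> x
  proof
    interpret R: complex_frechet_operator scale "\<lambda>y. scale \<mu> (T y)"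
      by (rule complex_frechet_operator_scaled)
    assume "AP_hypercyclic_vector (\<lambda>y. scale \<mu> (T y)) x"
    moreover have "cmod (inverse \<mu>) = 1"
      by (simp add: norm_inverse \<mu>)
    ultimately have "AP_hypercyclic_vector (\<lambda>y. scale (inverse \<mu>) (scale \<mu> (T y))) x"
      by (rule R.AP_hypercyclic_vector_rotation)
    moreover have "\<mu> \<noteq> 0"
      using \<mu> by auto
    ultimately show "AP_hypercyclic_vector T x"
      by simp
  qed (rule AP_hypercyclic_vector_rotation[OF _ \<mu>])
  show ?thesis
    using assms(4) by (auto simp: AP_hypercyclic_def powers rotations)
qed

end
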